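(* Let $\lambda\in\mathbb{Q}_{>0}$ and consider the $\lambda^\ast$-biased edge-reinforced random walk on $\mathbb{Z}$. Let $z\in\mathbb{Z}$. Then, on the event that $z$ is visited infinitely often: (i) if $\lambda>1$, then $\frac{\lambda\, w(n,z)}{w(n,z-1)+\lambda\, w(n,z)}$ converges almost surely to $1$ as $n\to\infty$; (ii) if $\lambda<1$, then $\frac{w(n,z-1)}{w(n,z-1)+\lambda\, w(n,z)}$ converges almost surely to $1$ as $n\to\infty$.
   Context: The $\lambda^\ast$-biased edge-reinforced random walk on $\mathbb{Z}$ is the nearest-neighbour process $(X_n)_{n\ge0}$ with $X_0=0$ and $$\mathbb{P}[X_{n+1}=x_n+1\mid X_n=x_n,\dots,X_0=x_0]=\frac{\lambda\, w(n,x_n)}{w(n,x_n-1)+\lambda\, w(n,x_n)},$$ and $X_{n+1}=x_n-1$ otherwise, where $w(n,z)$ is the weight of the edge $\{z,z+1\}$ at time $n$: $$w(n,z)=w(0,z)+\sum_{i=0}^{n-1}\left(\mathbf{1}_{X_i=z,\,X_{i+1}=z+1}+\mathbf{1}_{X_i=z+1,\,X_{i+1}=z}\right),\qquad w(0,z)=1\text{ for all }z\in\mathbb{Z}.$$ *)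

theory Defs
  imports "HOL-Probability.Probability"
begin

text \<open>
  \<open>errw_weight x n z\<close> is the weight at time \<open>n\<close> of the edge \<open>{z, z + 1}\<close> when the walk
  follows the trajectory \<open>x\<close>; it only depends on \<open>x 0, \<dots>, x n\<close>. All initial weights are 1.
\<close>

definition errw_weight :: "(nat \<Rightarrow> int) \<Rightarrow> nat \<Rightarrow> int \<Rightarrow> real" where
  "errw_weight x n z =
     1 + (\<Sum>i<n. of_bool (x i = z \<and> x (Suc i) = z + 1) + of_bool (x i = z + 1 \<and> x (Suc i) = z))"

text \<open>
  The conditional probability is prescribed only given histories of positive probability;
  \<^const>\<open>cond_prob\<close> is 0 by convention when the conditioning event is null.
\<close>

locale biased_errw = prob_space M
  for M :: "'a measure" and lam :: real and X :: "nat \<Rightarrow> 'a \<Rightarrow> int" +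
  assumes measurable_X: "\<And>n. random_variable (count_space UNIV) (X n)"
    and start: "AE \<omega> in M. X 0 \<omega> = 0"
    and nearest_neighbour: "\<And>n. AE \<omega> in M. X (Suc n) \<omega> = X n \<omega> + 1 \<or> X (Suc n) \<omega> = X n \<omega> - 1"
    and step_right: "\<And>n x. \<P>(\<omega> in M. \<forall>i\<le>n. X i \<omega> = x i) > 0 \<Longrightarrow>
      \<P>(\<omega> in M. X (Suc n) \<omega> = x n + 1 \<bar> \<forall>i\<le>n. X i \<omega> = x i) =
        lam * errw_weight x n (x n) / (errw_weight x n (x n - 1) + lam * errw_weight x n (x n))"

end

theory Submission
  imports Defs
begin

text \<open>
  Seen from \<open>z\<close>, the two adjacent edges form an urn. Count an excursion away from \<open>z\<close> as having
  already returned: then each departure from \<open>z\<close> adds exactly 2 to the weight of the edge taken, and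
  the weights do not move otherwise. Write \<open>a\<close> for the weight on the favoured side, \<open>b\<close> for the
  other, and \<open>\<rho> > 1\<close> for the bias. For suitable \<open>q < p\<close> the quantity \<open>b powr p / a powr q\<close>, corrected
  for small \<open>a\<close>, is a nonnegative supermartingale, hence almost surely bounded. So
  \<open>b \<le> C * a powr (q / p)\<close>, and since \<open>a + b\<close> tends to infinity when \<open>z\<close> is visited infinitely
  often, \<open>b / a\<close> tends to 0.
\<close>

section \<open>Urn weights of the two edges at \<open>z\<close>\<close>

text \<open>The indicators account for the return to \<open>z\<close>; for \<open>z \<noteq> 0\<close> they also anticipate the crossing
  that leads to the first visit.\<close>

definition left_weight :: "int \<Rightarrow> nat \<Rightarrow> (nat \<Rightarrow> int) \<Rightarrow> real" where
  "left_weight z n x = errw_weight x n (z - 1) + of_bool (x n < z)"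

definition right_weight :: "int \<Rightarrow> nat \<Rightarrow> (nat \<Rightarrow> int) \<Rightarrow> real" where
  "right_weight z n x = errw_weight x n z + of_bool (x n > z)"

lemma errw_weight_Suc:
  "errw_weight x (Suc n) z = errw_weight x n z +
     (of_bool (x n = z \<and> x (Suc n) = z + 1) + of_bool (x n = z + 1 \<and> x (Suc n) = z))"
  unfolding errw_weight_def by simp

lemma errw_weight_ge_1: "errw_weight x n z \<ge> 1"
  unfolding errw_weight_def by (auto intro!: sum_nonneg)

lemma errw_weight_cong: "(\<And>i. i \<le> n \<Longrightarrow> x i = y i) \<Longrightarrow> errw_weight x n z = errw_weight y n z"
  unfolding errw_weight_def by (auto intro!: sum.cong)

lemma left_weight_ge: "left_weight z n x \<ge> errw_weight x n (z - 1)"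
  and right_weight_ge: "right_weight z n x \<ge> errw_weight x n z"
  by (auto simp: left_weight_def right_weight_def)

lemma left_weight_le: "left_weight z n x \<le> 2 * errw_weight x n (z - 1)"
  and right_weight_le: "right_weight z n x \<le> 2 * errw_weight x n z"
  using errw_weight_ge_1[of x n "z - 1"] errw_weight_ge_1[of x n z]
  by (auto simp: left_weight_def right_weight_def of_bool_def)

lemma left_weight_ge_1: "left_weight z n x \<ge> 1"
  and right_weight_ge_1: "right_weight z n x \<ge> 1"
  using left_weight_ge right_weight_ge errw_weight_ge_1 order_trans by blast+

lemma left_weight_cong: "(\<And>i. i \<le> n \<Longrightarrow> x i = y i) \<Longrightarrow> left_weight z n x = left_weight z n y"
  and right_weight_cong: "(\<And>i. i \<le> n \<Longrightarrow> x i = y i) \<Longrightarrow> right_weight z n x = right_weight z n y"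
  using errw_weight_cong[of n x y] by (auto simp: left_weight_def right_weight_def)

text \<open>A departure to the left raises both the edge weight and the indicator by 1. On the way
  back the crossing adds 1 while the indicator drops by 1, so nothing changes. Since steps have size
  1, the indicator can change only when this edge is crossed.\<close>

lemma left_weight_Suc:
  assumes "x (Suc n) = x n + 1 \<or> x (Suc n) = x n - 1"
  shows "left_weight z (Suc n) x = left_weight z n x + 2 * of_bool (x n = z \<and> x (Suc n) = z - 1)"
  using assms by (auto simp: left_weight_def errw_weight_Suc of_bool_def)

lemma right_weight_Suc:
  assumes "x (Suc n) = x n + 1 \<or> x (Suc n) = x n - 1"
  shows "right_weight z (Suc n) x = right_weight z n x + 2 * of_bool (x n = z \<and> x (Suc n) = z + 1)"
  using assms by (auto simp: right_weight_def errw_weight_Suc of_bool_def)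

text \<open>Each visit to \<open>z\<close> is followed by a departure, which adds 2 to one of the
  two weights, so their sum dominates the number of visits so far.\<close>

lemma total_weight_at_top:
  assumes step: "\<And>n. x (Suc n) = x n + 1 \<or> x (Suc n) = x n - 1"
    and visits: "infinite {n. x n = z}"
  shows "filterlim (\<lambda>n. left_weight z n x + right_weight z n x) at_top sequentially"
proof -
  have eq: "left_weight z n x + right_weight z n x \<ge> real (card {i. i < n \<and> x i = z})" for n
  proof (induction n)
    case 0
    then show ?case using left_weight_ge_1[of z 0 x] right_weight_ge_1[of z 0 x] by simp
  next
    case (Suc n)
    have "{i. i < Suc n \<and> x i = z} = {i. i < n \<and> x i = z} \<union> (if x n = z then {n} else {})"
      by (auto simp: less_Suc_eq)
    then have "card {i. i < Suc n \<and> x i = z} \<le> card {i. i < n \<and> x i = z} + of_bool (x n = z)"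
      by (auto simp: of_bool_def intro: card_Un_le[THEN order_trans])
    then have "real (card {i. i < Suc n \<and> x i = z}) \<le> real (card {i. i < n \<and> x i = z}) + of_bool (x n = z)"
      by (auto simp: of_bool_def split: if_splits)
    moreover have "left_weight z (Suc n) x + right_weight z (Suc n) x
        = left_weight z n x + right_weight z n x + 2 * of_bool (x n = z)"
      using step[of n] by (auto simp: left_weight_Suc right_weight_Suc)
    moreover have "of_bool (x n = z) \<ge> (0::real)" by simp
    ultimately show ?case using Suc by linarith
  qed
  have "\<exists>N. \<forall>n\<ge>N. m \<le> card {i. i < n \<and> x i = z}" for m
  proof -
    obtain T where T: "finite T" "card T = m" "T \<subseteq> {n. x n = z}"
      using infinite_arbitrarily_large[OF visits] by blast
    obtain N where "\<forall>i\<in>T. i < N" using T(1) finite_nat_set_iff_bounded by blast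
    then have "m \<le> card {i. i < n \<and> x i = z}" if "n \<ge> N" for n
      unfolding T(2)[symmetric] using \<open>\<forall>i\<in>T. i < N\<close> T(3) that by (intro card_mono) fastforce+
    then show ?thesis by blast
  qed
  then have "filterlim (\<lambda>n. card {i. i < n \<and> x i = z}) at_top sequentially"
    by (auto simp: filterlim_at_top eventually_sequentially)
  then have "filterlim (\<lambda>n. real (card {i. i < n \<and> x i = z})) at_top sequentially"
    using filterlim_compose filterlim_real_sequentially by blast
  then show ?thesis
    by (rule filterlim_at_top_mono) (use eq in auto)
qed

section \<open>Finite histories and their probabilities\<close>

context biased_errw
begin

definition history :: "nat \<Rightarrow> (nat \<Rightarrow> int) \<Rightarrow> 'a set" where
  "history n x = {\<omega> \<in> space M. \<forall>i\<le>n. X i \<omega> = x i}"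

lemma history_events [measurable]: "history n x \<in> events"
proof -
  note measurable_X[measurable]
  show ?thesis unfolding history_def by measurable
qed

text \<open>A property of the first \<open>n + 1\<close> positions is a countable union of
  histories. This gives measurability of every event about the weights without treating them as
  random variables.\<close>

lemma nonanticipating_events:
  assumes "\<And>x y. (\<And>i. i \<le> n \<Longrightarrow> x i = y i) \<Longrightarrow> Q x \<longleftrightarrow> Q y"
  shows "{\<omega> \<in> space M. Q (\<lambda>i. X i \<omega>)} \<in> events"
proof -
  \<comment> \<open>The index set consists of lists because \<open>int list\<close> is countable,
    unlike the set of trajectories. Lists shorter than \<open>n + 1\<close> do no harm:
    \<open>l ! i\<close> is still some fixed integer.\<close>
  have "{\<omega> \<in> space M. Q (\<lambda>i. X i \<omega>)} = (\<Union>l\<in>{l. Q (\<lambda>i. l ! i)}. history n (\<lambda>i. l ! i))"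
  proof (intro set_eqI iffI)
    fix \<omega> assume *: "\<omega> \<in> {\<omega> \<in> space M. Q (\<lambda>i. X i \<omega>)}"
    let ?l = "map (\<lambda>i. X i \<omega>) [0..<Suc n]"
    have l: "?l ! i = X i \<omega>" if "i \<le> n" for i
      using that by (metis add_0 diff_zero le_imp_less_Suc nth_map_upt)
    have "Q (\<lambda>i. ?l ! i)" using assms[of "\<lambda>i. ?l ! i" "\<lambda>i. X i \<omega>"] l * by auto
    moreover have "\<omega> \<in> history n (\<lambda>i. ?l ! i)" using l * by (auto simp: history_def)
    ultimately show "\<omega> \<in> (\<Union>l\<in>{l. Q (\<lambda>i. l ! i)}. history n (\<lambda>i. l ! i))" by blast
  next
    fix \<omega> assume "\<omega> \<in> (\<Union>l\<in>{l. Q (\<lambda>i. l ! i)}. history n (\<lambda>i. l ! i))"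
    then obtain l where "Q (\<lambda>i. l ! i)" "\<omega> \<in> history n (\<lambda>i. l ! i)" by blast
    then show "\<omega> \<in> {\<omega> \<in> space M. Q (\<lambda>i. X i \<omega>)}"
      using assms[of "\<lambda>i. l ! i" "\<lambda>i. X i \<omega>"] by (auto simp: history_def)
  qed
  also have "\<dots> \<in> events" by (intro sets.countable_UN'') auto
  finally show ?thesis .
qed

lemma history_Suc:
  "history (Suc n) (x(Suc n := y)) = {\<omega> \<in> space M. X (Suc n) \<omega> = y \<and> (\<forall>i\<le>n. X i \<omega> = x i)}"
  unfolding history_def by (auto simp: le_Suc_eq)

lemma prob_history_split:
  "prob (history n x) =
     prob (history (Suc n) (x(Suc n := x n + 1))) + prob (history (Suc n) (x(Suc n := x n - 1)))"
proof -
  have "prob (history n x) =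
      prob (history (Suc n) (x(Suc n := x n + 1)) \<union> history (Suc n) (x(Suc n := x n - 1)))"
  proof (rule finite_measure_eq_AE)
    show "AE \<omega> in M. \<omega> \<in> history n x \<longleftrightarrow>
        \<omega> \<in> history (Suc n) (x(Suc n := x n + 1)) \<union> history (Suc n) (x(Suc n := x n - 1))"
      using nearest_neighbour[of n]
      by eventually_elim (auto simp: history_Suc, auto simp: history_def)
  qed (intro sets.Un history_events)+
  also have "\<dots> = prob (history (Suc n) (x(Suc n := x n + 1))) + prob (history (Suc n) (x(Suc n := x n - 1)))"
    by (rule finite_measure_Union[OF history_events history_events]) (auto simp: history_Suc)
  finally show ?thesis .
qed

text \<open>This is the transition rule with denominators cleared. In this form it also covers null
  histories, about which \<open>step_right\<close> says nothing: their extensions are null too, so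
  both sides vanish.\<close>

lemma prob_history_right:
  assumes "lam > 0"
  defines "r \<equiv> \<lambda>n x. lam * errw_weight x n (x n)" and "l \<equiv> \<lambda>n x. errw_weight x n (x n - 1)"
  shows "(l n x + r n x) * prob (history (Suc n) (x(Suc n := x n + 1))) = r n x * prob (history n x)"
proof (cases "prob (history n x) = 0")
  case True
  then show ?thesis using prob_history_split[of n x]
    by (simp add: add_nonneg_eq_0_iff)
next
  case False
  then have pos: "prob (history n x) > 0" by (simp add: zero_less_measure_iff)
  have "l n x + r n x > 0" using errw_weight_ge_1[of x n "x n"] errw_weight_ge_1[of x n "x n - 1"] assms
    by (auto intro!: add_pos_pos simp: l_def r_def)
  moreover have "prob (history (Suc n) (x(Suc n := x n + 1))) / prob (history n x) = r n x / (l n x + r n x)"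
    using step_right[of n x] pos
    unfolding cond_prob_def history_Suc r_def l_def by (simp add: history_def)
  ultimately show ?thesis using pos by (simp add: field_simps)
qed

lemma prob_history_left:
  assumes "lam > 0"
  defines "r \<equiv> \<lambda>n x. lam * errw_weight x n (x n)" and "l \<equiv> \<lambda>n x. errw_weight x n (x n - 1)"
  shows "(l n x + r n x) * prob (history (Suc n) (x(Suc n := x n - 1))) = l n x * prob (history n x)"
  using prob_history_right[OF assms(1), of x n] prob_history_split[of n x]
  unfolding r_def l_def by (simp add: algebra_simps)

section \<open>Maximal inequality and almost sure boundedness\<close>

text \<open>Ville's maximal inequality; splitting over the first step after time \<open>n\<close> gives an induction
  on the length \<open>m\<close> of the time window that needs no integration.\<close>

lemma maximal_inequality:
  fixes V :: "nat \<Rightarrow> (nat \<Rightarrow> int) \<Rightarrow> real"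
  assumes lam: "lam > 0" and c: "c > 0"
    and nonneg: "\<And>n x. V n x \<ge> 0"
    and cong: "\<And>n x y. (\<And>i. i \<le> n \<Longrightarrow> x i = y i) \<Longrightarrow> V n x = V n y"
    and super: "\<And>n x. lam * errw_weight x n (x n) * V (Suc n) (x(Suc n := x n + 1))
        + errw_weight x n (x n - 1) * V (Suc n) (x(Suc n := x n - 1))
        \<le> (errw_weight x n (x n - 1) + lam * errw_weight x n (x n)) * V n x"
  shows "c * prob (history n x \<inter> (\<Union>k\<in>{n..n+m}. {\<omega> \<in> space M. V k (\<lambda>i. X i \<omega>) \<ge> c}))
    \<le> prob (history n x) * V n x"
proof (induction m arbitrary: n x)
  have ev: "{\<omega> \<in> space M. V k (\<lambda>i. X i \<omega>) \<ge> c} \<in> events" for k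
    by (rule nonanticipating_events[of k]) (metis cong)
  \<comment> \<open>Once the level is reached the dynamics are irrelevant: the event is contained in
    the history, and \<open>c\<close> is at most \<open>V n x\<close>.\<close>
  have hit: "c * prob (history n x \<inter> B) \<le> prob (history n x) * V n x" if "V n x \<ge> c" for B n x
  proof -
    have "c * prob (history n x \<inter> B) \<le> V n x * prob (history n x)"
      using that c by (intro mult_mono finite_measure_mono) auto
    then show ?thesis by (simp add: mult.commute)
  qed
  have V_hist: "V n (\<lambda>i. X i \<omega>) = V n x" if "\<omega> \<in> history n x" for \<omega> n x
    using that by (intro cong) (auto simp: history_def)
  {
    case 0
    show ?case
    proof (cases "V n x \<ge> c")
      case False
      then have "history n x \<inter> (\<Union>k\<in>{n..n+0}. {\<omega> \<in> space M. V k (\<lambda>i. X i \<omega>) \<ge> c}) = {}"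
        using V_hist by fastforce
      then show ?thesis by (simp only: measure_empty) (simp add: nonneg)
    qed (rule hit)
  next
    case (Suc m)
    let ?E = "\<lambda>n m. \<Union>k\<in>{n..n+m}. {\<omega> \<in> space M. V k (\<lambda>i. X i \<omega>) \<ge> c}"
    let ?H = "history n x" and ?R = "history (Suc n) (x(Suc n := x n + 1))"
      and ?L = "history (Suc n) (x(Suc n := x n - 1))"
    let ?r = "lam * errw_weight x n (x n)" and ?l = "errw_weight x n (x n - 1)"
    let ?VR = "V (Suc n) (x(Suc n := x n + 1))" and ?VL = "V (Suc n) (x(Suc n := x n - 1))"
    show ?case
    proof (cases "V n x \<ge> c")
      case False
      have E: "?E n m \<in> events" for n m using ev by (intro sets.finite_UN) auto
      \<comment> \<open>Below the level at time \<open>n\<close>, the hit must come at time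
        \<open>Suc n\<close> or later. The window of length \<open>Suc m\<close> from
        \<open>n\<close> thus shrinks to one of length \<open>m\<close> from \<open>Suc n\<close>,
        after a step to either side.\<close>
      have "AE \<omega> in M. \<omega> \<in> ?H \<inter> ?E n (Suc m) \<longrightarrow> \<omega> \<in> (?R \<inter> ?E (Suc n) m) \<union> (?L \<inter> ?E (Suc n) m)"
        using nearest_neighbour[of n]
      proof (eventually_elim, intro impI)
        fix \<omega> assume step: "X (Suc n) \<omega> = X n \<omega> + 1 \<or> X (Suc n) \<omega> = X n \<omega> - 1"
          and in_HE: "\<omega> \<in> ?H \<inter> ?E n (Suc m)"
        then obtain k where k: "n \<le> k" "k \<le> n + Suc m" "V k (\<lambda>i. X i \<omega>) \<ge> c" by auto
        moreover have "k \<noteq> n" using k V_hist[of \<omega> n x] in_HE False by auto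
        ultimately have "\<omega> \<in> ?E (Suc n) m" using in_HE by (auto intro!: bexI[of _ k])
        then show "\<omega> \<in> (?R \<inter> ?E (Suc n) m) \<union> (?L \<inter> ?E (Suc n) m)"
          using step in_HE by (auto simp: history_Suc) (auto simp: history_def)
      qed
      then have "prob (?H \<inter> ?E n (Suc m)) \<le> prob ((?R \<inter> ?E (Suc n) m) \<union> (?L \<inter> ?E (Suc n) m))"
        by (rule finite_measure_mono_AE) (intro sets.Un sets.Int history_events E)
      also have "\<dots> \<le> prob (?R \<inter> ?E (Suc n) m) + prob (?L \<inter> ?E (Suc n) m)"
        by (intro measure_Un_le sets.Int history_events E)
      finally have "c * prob (?H \<inter> ?E n (Suc m)) \<le>
          c * prob (?R \<inter> ?E (Suc n) m) + c * prob (?L \<inter> ?E (Suc n) m)"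
        using c by (simp flip: distrib_left)
      also have "\<dots> \<le> prob ?R * ?VR + prob ?L * ?VL"
        by (intro add_mono Suc)
      finally have bound: "c * prob (?H \<inter> ?E n (Suc m)) \<le> prob ?R * ?VR + prob ?L * ?VL" .
      have tot: "?l + ?r > 0"
        using errw_weight_ge_1[of x n "x n"] errw_weight_ge_1[of x n "x n - 1"] lam
        by (auto intro!: add_pos_pos)
      \<comment> \<open>Multiplying by the positive total weight makes the cleared transition rules
        applicable; the factor is cancelled at the end.\<close>
      have "(?l + ?r) * (prob ?R * ?VR + prob ?L * ?VL) =
          ((?l + ?r) * prob ?R) * ?VR + ((?l + ?r) * prob ?L) * ?VL"
        by (simp only: distrib_left mult.assoc)
      also have "\<dots> = prob ?H * (?r * ?VR + ?l * ?VL)"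
        unfolding prob_history_right[OF lam] prob_history_left[OF lam] by (simp add: algebra_simps)
      also have "\<dots> \<le> prob ?H * ((?l + ?r) * V n x)"
        by (intro mult_left_mono super) auto
      also have "\<dots> = (?l + ?r) * (prob ?H * V n x)" by simp
      finally have "prob ?R * ?VR + prob ?L * ?VL \<le> prob ?H * V n x"
        using tot by (simp only: mult_le_cancel_left_pos)
      with bound show ?thesis by linarith
    qed (rule hit)
  }
qed

text \<open>The maximal inequality from time 0 bounds the probability of ever reaching level
  \<open>c\<close> by a constant over \<open>c\<close>, and this tends to 0 as \<open>c\<close>
  grows.\<close>

lemma AE_supermartingale_bounded:
  fixes V :: "nat \<Rightarrow> (nat \<Rightarrow> int) \<Rightarrow> real"
  assumes lam: "lam > 0"
    and nonneg: "\<And>n x. V n x \<ge> 0"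
    and cong: "\<And>n x y. (\<And>i. i \<le> n \<Longrightarrow> x i = y i) \<Longrightarrow> V n x = V n y"
    and super: "\<And>n x. lam * errw_weight x n (x n) * V (Suc n) (x(Suc n := x n + 1))
        + errw_weight x n (x n - 1) * V (Suc n) (x(Suc n := x n - 1))
        \<le> (errw_weight x n (x n - 1) + lam * errw_weight x n (x n)) * V n x"
  shows "AE \<omega> in M. \<exists>c>0. \<forall>k. V k (\<lambda>i. X i \<omega>) < c"
proof -
  let ?A = "\<lambda>c k. {\<omega> \<in> space M. V k (\<lambda>i. X i \<omega>) \<ge> c}"
  have ev: "?A c k \<in> events" for c k
    by (rule nonanticipating_events[of k]) (metis cong)
  have le: "c * prob (\<Union>k. ?A c k) \<le> V 0 (\<lambda>_. 0)" if c: "c > 0" for c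
  proof -
    have bound: "c * prob (\<Union>k\<in>{..m}. ?A c k) \<le> V 0 (\<lambda>_. 0)" for m
    proof -
      \<comment> \<open>The walk starts at 0 almost surely, so intersecting with this history loses
        no probability.\<close>
      have "prob (\<Union>k\<in>{..m}. ?A c k) \<le> prob (history 0 (\<lambda>_. 0) \<inter> (\<Union>k\<in>{0..0+m}. ?A c k))"
      proof (rule finite_measure_mono_AE)
        show "AE \<omega> in M. \<omega> \<in> (\<Union>k\<in>{..m}. ?A c k) \<longrightarrow>
            \<omega> \<in> history 0 (\<lambda>_. 0) \<inter> (\<Union>k\<in>{0..0+m}. ?A c k)"
          using start by eventually_elim (auto simp: history_def)
      qed (intro sets.Int history_events sets.finite_UN ev finite_atLeastAtMost)
      then have "c * prob (\<Union>k\<in>{..m}. ?A c k) \<le> c * prob (history 0 (\<lambda>_. 0) \<inter> (\<Union>k\<in>{0..0+m}. ?A c k))"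
        using c by simp
      also have "\<dots> \<le> prob (history 0 (\<lambda>_. 0)) * V 0 (\<lambda>_. 0)"
        by (rule maximal_inequality[OF lam c nonneg cong super])
      also have "\<dots> \<le> V 0 (\<lambda>_. 0)" using nonneg by (simp add: mult_left_le_one_le)
      finally show ?thesis .
    qed
    have "(\<lambda>m. prob (\<Union>k\<in>{..m}. ?A c k)) \<longlonglongrightarrow> prob (\<Union>m. \<Union>k\<in>{..m}. ?A c k)"
      using ev by (intro finite_Lim_measure_incseq) (auto simp: incseq_def intro: order_trans)
    also have "(\<Union>m. \<Union>k\<in>{..m}. ?A c k) = (\<Union>k. ?A c k)" by auto
    finally have "(\<lambda>m. c * prob (\<Union>k\<in>{..m}. ?A c k)) \<longlonglongrightarrow> c * prob (\<Union>k. ?A c k)"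
      by (intro tendsto_intros)
    then show ?thesis by (rule LIMSEQ_le_const2) (use bound in auto)
  qed
  \<comment> \<open>\<open>?B\<close> is the event that \<open>V\<close> is unbounded along the
    trajectory. Integer levels keep the intersection countable.\<close>
  let ?B = "\<Inter>c. \<Union>k. ?A (real (Suc c)) k"
  have B: "?B \<in> events" using ev by auto
  have small: "prob ?B \<le> V 0 (\<lambda>_. 0) / real (Suc c)" for c
  proof -
    have "prob ?B \<le> prob (\<Union>k. ?A (real (Suc c)) k)"
      using ev by (intro finite_measure_mono) auto
    also have "\<dots> \<le> V 0 (\<lambda>_. 0) / real (Suc c)"
      using le[of "real (Suc c)"] by (simp add: field_simps)
    finally show ?thesis .
  qed
  have "(\<lambda>c. V 0 (\<lambda>_. 0) / real (Suc c)) \<longlonglongrightarrow> 0"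
    by (intro LIMSEQ_Suc lim_const_over_n)
  then have "prob ?B \<le> 0" by (rule LIMSEQ_le_const) (use small in auto)
  then have "prob ?B = 0" by (simp add: measure_le_0_iff)
  then have "AE \<omega> in M. \<omega> \<notin> ?B" using B prob_eq_0 by blast
  then show ?thesis
    using AE_space
  proof eventually_elim
    case (elim \<omega>)
    then obtain c where "\<forall>k. V k (\<lambda>i. X i \<omega>) < real (Suc c)" by (auto simp: not_le)
    then show ?case by (intro exI[of _ "real (Suc c)"]) auto
  qed
qed

text \<open>Away from \<open>z\<close> a step leaves both urn weights unchanged, so the
  supermartingale condition is an equality. At \<open>z\<close> the indicators vanish and the urn
  weights are the true edge weights, so the condition becomes the inequality for an urn with
  increments 2.\<close>

lemma AE_function_of_weights_bounded:
  fixes F :: "real \<Rightarrow> real \<Rightarrow> real"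
  assumes lam: "lam > 0"
    and nonneg: "\<And>l r. F l r \<ge> 0"
    and super: "\<And>l r. l \<ge> 1 \<Longrightarrow> r \<ge> 1 \<Longrightarrow>
      lam * r * F l (r + 2) + l * F (l + 2) r \<le> (l + lam * r) * F l r"
  shows "AE \<omega> in M. \<exists>c>0. \<forall>k. F (left_weight z k (\<lambda>i. X i \<omega>)) (right_weight z k (\<lambda>i. X i \<omega>)) < c"
proof (rule AE_supermartingale_bounded[OF lam, where V = "\<lambda>k x. F (left_weight z k x) (right_weight z k x)"])
  fix n :: nat and x :: "nat \<Rightarrow> int"
  let ?F = "\<lambda>k x. F (left_weight z k x) (right_weight z k x)"
  let ?xr = "x(Suc n := x n + 1)" and ?xl = "x(Suc n := x n - 1)"
  have w: "left_weight z n (x(Suc n := y)) = left_weight z n x"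
    "right_weight z n (x(Suc n := y)) = right_weight z n x" for y
    by (auto intro!: left_weight_cong right_weight_cong)
  have wr: "left_weight z (Suc n) ?xr = left_weight z n x"
    "right_weight z (Suc n) ?xr = right_weight z n x + 2 * of_bool (x n = z)"
    by (simp_all add: left_weight_Suc right_weight_Suc w)
  have wl: "left_weight z (Suc n) ?xl = left_weight z n x + 2 * of_bool (x n = z)"
    "right_weight z (Suc n) ?xl = right_weight z n x"
    by (simp_all add: left_weight_Suc right_weight_Suc w)
  show "lam * errw_weight x n (x n) * ?F (Suc n) ?xr + errw_weight x n (x n - 1) * ?F (Suc n) ?xl
    \<le> (errw_weight x n (x n - 1) + lam * errw_weight x n (x n)) * ?F n x"
  proof (cases "x n = z")
    case True
    then have "errw_weight x n (x n) = right_weight z n x" "errw_weight x n (x n - 1) = left_weight z n x"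
      by (auto simp: left_weight_def right_weight_def)
    then show ?thesis unfolding wl wr
      using True super[OF left_weight_ge_1[of z n x] right_weight_ge_1[of z n x]] by simp
  next
    case False
    then show ?thesis unfolding wl wr by (simp add: algebra_simps)
  qed
next
  fix n :: nat and x y :: "nat \<Rightarrow> int"
  assume xy: "\<And>i. i \<le> n \<Longrightarrow> x i = y i"
  show "F (left_weight z n x) (right_weight z n x) = F (left_weight z n y) (right_weight z n y)"
    using left_weight_cong[of n x y z] right_weight_cong[of n x y z] xy by simp
qed (rule nonneg)

end

section \<open>Supermartingale property of the urn potential\<close>

text \<open>The gain from increasing \<open>b\<close> is at most the factor \<open>1 + 1 / (2 * b)\<close>. The power of \<open>a\<close> alone would only
  compensate it for large \<open>a\<close>; the power of 2 makes up for small \<open>a\<close>.\<close>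

definition urn_potential :: "real \<Rightarrow> real \<Rightarrow> real \<Rightarrow> real" where
  "urn_potential \<rho> a b =
     b powr (1/4) * (a powr (-((1 + 1/\<rho>) / 8)) * 2 powr max 0 (1 + 4 / (\<rho> - 1) - a))"

text \<open>Bernoulli's inequality for exponents in [0, 1], obtained from the weighted AM-GM
  inequality for \<open>1 + t\<close> and 1.\<close>

lemma powr_one_plus_le:
  fixes t q :: real
  assumes "t > -1" "0 \<le> q" "q \<le> 1"
  shows "(1 + t) powr q \<le> 1 + q * t"
  using Youngs_inequality_0[of q "1 - q" "1 + t" 1] assms by (simp add: algebra_simps)

text \<open>Raising \<open>b\<close> multiplies the potential by at most
  \<open>1 + 1 / (2 * b)\<close>, raising \<open>a\<close> by at most
  \<open>1 - 1 / (2 * \<rho> * a)\<close>. Weighted by \<open>b\<close> and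
  \<open>\<rho> * a\<close>, the relative changes are +1/2 and -1/2 and cancel exactly.\<close>

lemma urn_potential_supermartingale:
  assumes "\<rho> > 1" "a \<ge> 1" "b \<ge> 1"
  shows "\<rho> * a * urn_potential \<rho> (a + 2) b + b * urn_potential \<rho> a (b + 2)
    \<le> (b + \<rho> * a) * urn_potential \<rho> a b"
proof -
  \<comment> \<open>\<open>q\<close> is the midpoint of \<open>1 / (4 * \<rho>)\<close> and
    \<open>1/4\<close>. Above the former, the loss from \<open>a\<close> wins for large
    \<open>a\<close>; below the latter, a bounded potential forces \<open>b\<close> to grow more
    slowly than \<open>a\<close>.\<close>
  define q where "q = (1 + 1/\<rho>) / 8"
  define K where "K = 1 + 4 / (\<rho> - 1)"
  define h where "h = (\<lambda>a. a powr (-q) * 2 powr max 0 (K - a))"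
  have U: "urn_potential \<rho> a b = b powr (1/4) * h a" for a b
    by (simp add: urn_potential_def h_def q_def K_def)
  have q: "0 < q" "q \<le> 1" using assms by (auto simp: q_def field_simps)
  have h_nonneg: "h a \<ge> 0" for a by (simp add: h_def)
  have "(b + 2) powr (1/4) = b powr (1/4) * (1 + 2/b) powr (1/4)"
    using assms by (simp add: distrib_left flip: powr_mult)
  also have "\<dots> \<le> b powr (1/4) * (1 + 1/4 * (2/b))"
    using assms by (intro mult_left_mono powr_one_plus_le) (auto intro: less_le_trans[of _ 0])
  also have "\<dots> = b powr (1/4) * (1 + 1 / (2 * b))" by simp
  finally have b_le: "(b + 2) powr (1/4) \<le> b powr (1/4) * (1 + 1 / (2 * b))" .
  have h_le: "h (a + 2) \<le> h a * (1 - 1 / (2 * \<rho> * a))"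
  proof (cases "a \<le> K - 1")
    case True
    \<comment> \<open>For \<open>a \<le> K - 1\<close> the exponent of 2 falls by at least 1, so
      \<open>h\<close> is at least halved, which is enough as
      \<open>\<rho> * a \<ge> 1\<close>.\<close>
    have "h (a + 2) \<le> a powr (-q) * 2 powr (K - a - 1)"
      unfolding h_def using True assms q by (intro mult_mono powr_mono powr_mono2') auto
    also have "\<dots> = h a * (1/2)" using True by (simp add: h_def powr_diff)
    also have "\<dots> \<le> h a * (1 - 1 / (2 * \<rho> * a))"
    proof (intro mult_left_mono h_nonneg)
      have "1 * 1 \<le> \<rho> * a" using assms by (intro mult_mono) auto
      then show "1/2 \<le> 1 - 1 / (2 * \<rho> * a)" using assms by (simp add: field_simps)
    qed
    finally show ?thesis .
  next
    case False
    \<comment> \<open>This is exactly the condition under which the decay of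
      \<open>a powr (-q)\<close> alone suffices; it dictates the value of \<open>K\<close>.\<close>
    then have "4 \<le> (\<rho> - 1) * a" using assms by (simp add: K_def field_simps)
    then have q_ge: "1 / (2 * \<rho> * a) \<le> q * (2 / (a + 2))"
      using assms by (simp add: q_def divide_simps) (simp add: algebra_simps)
    have "(a + 2) powr (-q) = a powr (-q) * (a / (a + 2)) powr q"
      using assms by (simp add: powr_divide powr_minus field_simps)
    also have "a / (a + 2) = 1 + - (2 / (a + 2))" using assms by (simp add: field_simps)
    also have "(1 + - (2 / (a + 2))) powr q \<le> 1 + q * - (2 / (a + 2))"
      using assms q by (intro powr_one_plus_le) (auto simp: field_simps)
    also have "\<dots> \<le> 1 - 1 / (2 * \<rho> * a)" using q_ge by simp
    finally have "(a + 2) powr (-q) \<le> a powr (-q) * (1 - 1 / (2 * \<rho> * a))"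
      by (simp add: mult_left_mono)
    then have "(a + 2) powr (-q) * 2 powr max 0 (K - a)
        \<le> (a powr (-q) * (1 - 1 / (2 * \<rho> * a))) * 2 powr max 0 (K - a)"
      by (rule mult_right_mono) simp
    moreover have "h (a + 2) \<le> (a + 2) powr (-q) * 2 powr max 0 (K - a)"
      unfolding h_def by (intro mult_left_mono powr_mono) auto
    ultimately have "h (a + 2) \<le> (a powr (-q) * (1 - 1 / (2 * \<rho> * a))) * 2 powr max 0 (K - a)"
      by (rule order_trans[rotated])
    then show ?thesis by (simp add: h_def mult_ac)
  qed
  have "\<rho> * a * urn_potential \<rho> (a + 2) b + b * urn_potential \<rho> a (b + 2)
      = \<rho> * a * b powr (1/4) * h (a + 2) + b * h a * (b + 2) powr (1/4)"
    by (simp add: U)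
  also have "\<dots> \<le> \<rho> * a * b powr (1/4) * (h a * (1 - 1 / (2 * \<rho> * a)))
      + b * h a * (b powr (1/4) * (1 + 1 / (2 * b)))"
    using assms h_nonneg by (intro add_mono mult_left_mono h_le b_le) auto
  also have "\<dots> = (b + \<rho> * a) * urn_potential \<rho> a b"
    using assms by (simp add: U field_simps)
  finally show ?thesis .
qed

section \<open>From bounded potential to limits of weights\<close>

lemma urn_ratio_tendsto_0:
  fixes a b :: "nat \<Rightarrow> real"
  assumes \<rho>: "\<rho> > 1"
    and ge: "\<And>n. a n \<ge> 1" "\<And>n. b n \<ge> 1"
    and sum: "filterlim (\<lambda>n. a n + b n) at_top sequentially"
    and bounded: "\<And>n. urn_potential \<rho> (a n) (b n) < c"
  shows "(\<lambda>n. b n / a n) \<longlonglongrightarrow> 0"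
proof -
  \<comment> \<open>\<open>\<theta>\<close> is the exponent of \<open>a\<close> in the potential, up
    to sign, divided by the exponent \<open>1/4\<close> of \<open>b\<close>.\<close>
  define \<theta> where "\<theta> = (1 + 1/\<rho>) / 2"
  have \<theta>: "\<theta> < 1" using \<rho> by (simp add: \<theta>_def field_simps)
  have c: "c > 0" using bounded[of 0] by (auto simp: urn_potential_def intro: le_less_trans[rotated])
  have b_le: "b n \<le> c powr 4 * a n powr \<theta>" for n
  proof -
    have "b n powr (1/4) * a n powr (-(\<theta>/4)) * 1 \<le>
        b n powr (1/4) * a n powr (-(\<theta>/4)) * 2 powr max 0 (1 + 4 / (\<rho> - 1) - a n)"
      by (intro mult_left_mono ge_one_powr_ge_zero) auto
    also have "\<dots> < c"
      using bounded[of n] by (simp add: urn_potential_def \<theta>_def mult.assoc)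
    finally have "b n powr (1/4) \<le> c * a n powr (\<theta>/4)"
      using ge[of n] by (simp add: powr_minus field_simps)
    then have "(b n powr (1/4)) powr 4 \<le> (c * a n powr (\<theta>/4)) powr 4"
      by (intro powr_mono2) auto
    then show ?thesis using ge[of n] c by (simp add: powr_powr powr_mult)
  qed
  \<comment> \<open>The sum diverges by assumption; bounding it by a multiple of \<open>a\<close>
    shows that \<open>a\<close> itself diverges.\<close>
  have "a n + b n \<le> (1 + c powr 4) * a n" for n
  proof -
    have "a n powr \<theta> \<le> a n powr 1" using ge[of n] \<theta> by (intro powr_mono) auto
    then have "c powr 4 * a n powr \<theta> \<le> c powr 4 * a n"
      using ge(1)[of n] by (intro mult_left_mono) auto
    then show ?thesis using b_le[of n] by (simp add: algebra_simps)
  qed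
  then have "filterlim (\<lambda>n. (1 + c powr 4) * a n) at_top sequentially"
    using sum by (intro filterlim_at_top_mono[OF sum]) auto
  moreover have pos: "1 + c powr 4 > 0" by (simp add: add_pos_nonneg)
  ultimately have "filterlim a at_top sequentially"
    using filterlim_tendsto_pos_mult_at_top_iff[OF tendsto_const pos] by blast
  then have "(\<lambda>n. a n powr (\<theta> - 1)) \<longlonglongrightarrow> 0"
    using \<theta> by (intro tendsto_neg_powr) auto
  then have "(\<lambda>n. c powr 4 * a n powr (\<theta> - 1)) \<longlonglongrightarrow> 0"
    by (rule tendsto_mult_right_zero)
  then show ?thesis
  proof (rule tendsto_sandwich[OF _ _ tendsto_const, rotated 2])
    show "\<forall>\<^sub>F n in sequentially. 0 \<le> b n / a n"
      using ge by (intro always_eventually allI divide_nonneg_nonneg) (auto intro: order_trans[of _ 1])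
    show "\<forall>\<^sub>F n in sequentially. b n / a n \<le> c powr 4 * a n powr (\<theta> - 1)"
    proof (intro always_eventually allI)
      fix n show "b n / a n \<le> c powr 4 * a n powr (\<theta> - 1)"
        using b_le[of n] ge(1)[of n] by (simp add: powr_diff field_simps)
    qed
  qed
qed

text \<open>This returns from urn weights to edge weights: \<open>a\<close> and \<open>b\<close> are
  the urn weights of the favoured and the other side, \<open>u\<close> and \<open>v\<close> the
  corresponding edge weights. The indicators cost at most a factor 2 in the ratio.\<close>

lemma biased_fraction_tendsto_1:
  fixes u v a b :: "nat \<Rightarrow> real"
  assumes "k > 0" and ratio: "(\<lambda>n. b n / a n) \<longlonglongrightarrow> 0"
    and v: "\<And>n. v n \<ge> 1" "\<And>n. v n \<le> b n" and u: "\<And>n. u n \<ge> 1" "\<And>n. a n \<le> 2 * u n" "\<And>n. a n \<ge> 1"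
  shows "(\<lambda>n. k * u n / (v n + k * u n)) \<longlonglongrightarrow> 1"
proof -
  have "(\<lambda>n. 2 * (b n / a n)) \<longlonglongrightarrow> 0" using ratio by (rule tendsto_mult_right_zero)
  then have "(\<lambda>n. v n / u n) \<longlonglongrightarrow> 0"
  proof (rule tendsto_sandwich[OF _ _ tendsto_const, rotated 2])
    show "\<forall>\<^sub>F n in sequentially. 0 \<le> v n / u n"
      using v(1) u(1) by (intro always_eventually allI divide_nonneg_nonneg) (auto intro: order_trans[of _ 1])
    show "\<forall>\<^sub>F n in sequentially. v n / u n \<le> 2 * (b n / a n)"
    proof (intro always_eventually allI)
      fix n
      have "v n / u n \<le> b n / (a n / 2)"
        using v[of n] u[of n] by (intro frac_le) auto
      then show "v n / u n \<le> 2 * (b n / a n)" by (simp add: mult.commute)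
    qed
  qed
  then have "(\<lambda>n. k / (v n / u n + k)) \<longlonglongrightarrow> k / (0 + k)"
    using \<open>k > 0\<close> by (intro tendsto_intros) auto
  moreover have "k / (v n / u n + k) = k * u n / (v n + k * u n)" for n
    using u(1)[of n] v(1)[of n] \<open>k > 0\<close> by (simp add: field_simps)
  ultimately show ?thesis using \<open>k > 0\<close> by simp
qed

section \<open>Almost sure convergence of the transition probabilities\<close>

theorem lemma6p2:
  fixes M :: "'a measure" and lam :: real and X :: "nat \<Rightarrow> 'a \<Rightarrow> int" and z :: int
  assumes "lam \<in> \<rat>" and "lam > 0"
    and "biased_errw M lam X"
  shows "(lam > 1 \<longrightarrow>
      (AE \<omega> in M. infinite {n. X n \<omega> = z} \<longrightarrow>
        (\<lambda>n. lam * errw_weight (\<lambda>i. X i \<omega>) n z /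
          (errw_weight (\<lambda>i. X i \<omega>) n (z - 1) + lam * errw_weight (\<lambda>i. X i \<omega>) n z))
          \<longlonglongrightarrow> 1)) \<and>
    (lam < 1 \<longrightarrow>
      (AE \<omega> in M. infinite {n. X n \<omega> = z} \<longrightarrow>
        (\<lambda>n. errw_weight (\<lambda>i. X i \<omega>) n (z - 1) /
          (errw_weight (\<lambda>i. X i \<omega>) n (z - 1) + lam * errw_weight (\<lambda>i. X i \<omega>) n z))
          \<longlonglongrightarrow> 1))"
proof (intro conjI impI)
  interpret biased_errw M lam X by fact
  have step: "AE \<omega> in M. \<forall>n. X (Suc n) \<omega> = X n \<omega> + 1 \<or> X (Suc n) \<omega> = X n \<omega> - 1"
    using nearest_neighbour by (simp add: AE_all_countable)
  {
    assume "lam > 1"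
    \<comment> \<open>The bias favours the right edge, so its weight takes the place of
      \<open>a\<close>.\<close>
    have "AE \<omega> in M. \<exists>c>0. \<forall>k. urn_potential lam (right_weight z k (\<lambda>i. X i \<omega>)) (left_weight z k (\<lambda>i. X i \<omega>)) < c"
    proof (rule AE_function_of_weights_bounded[OF \<open>lam > 0\<close>])
      show "lam * r * urn_potential lam (r + 2) l + l * urn_potential lam r (l + 2)
          \<le> (l + lam * r) * urn_potential lam r l" if "l \<ge> 1" "r \<ge> 1" for l r
        using urn_potential_supermartingale[OF \<open>lam > 1\<close>, of r l] that by simp
    qed (simp add: urn_potential_def)
    with step show "AE \<omega> in M. infinite {n. X n \<omega> = z} \<longrightarrow>
        (\<lambda>n. lam * errw_weight (\<lambda>i. X i \<omega>) n z /
          (errw_weight (\<lambda>i. X i \<omega>) n (z - 1) + lam * errw_weight (\<lambda>i. X i \<omega>) n z)) \<longlonglongrightarrow> 1"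
    proof (eventually_elim, intro impI)
      fix \<omega>
      let ?x = "\<lambda>i. X i \<omega>"
      assume x: "\<forall>n. X (Suc n) \<omega> = X n \<omega> + 1 \<or> X (Suc n) \<omega> = X n \<omega> - 1" "infinite {n. X n \<omega> = z}"
      assume "\<exists>c>0. \<forall>k. urn_potential lam (right_weight z k ?x) (left_weight z k ?x) < c"
      then obtain c where c: "\<And>k. urn_potential lam (right_weight z k ?x) (left_weight z k ?x) < c"
        by blast
      have "filterlim (\<lambda>n. left_weight z n ?x + right_weight z n ?x) at_top sequentially"
        using x by (intro total_weight_at_top) auto
      then have "(\<lambda>n. left_weight z n ?x / right_weight z n ?x) \<longlonglongrightarrow> 0"
        using c by (intro urn_ratio_tendsto_0[OF \<open>lam > 1\<close>])
          (auto simp: left_weight_ge_1 right_weight_ge_1 add.commute)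
      then show "(\<lambda>n. lam * errw_weight ?x n z / (errw_weight ?x n (z - 1) + lam * errw_weight ?x n z)) \<longlonglongrightarrow> 1"
        by (rule biased_fraction_tendsto_1[OF \<open>lam > 0\<close>])
          (rule errw_weight_ge_1 left_weight_ge right_weight_le right_weight_ge_1)+
    qed
  next
    assume "lam < 1"
    then have inv: "1 / lam > 1" using \<open>lam > 0\<close> by simp
    \<comment> \<open>Here the left edge is favoured, with bias \<open>1/lam\<close>. Multiplying
      the urn inequality by \<open>lam\<close> restores the weights \<open>l\<close> and
      \<open>lam * r\<close> of the walk.\<close>
    have "AE \<omega> in M. \<exists>c>0. \<forall>k. urn_potential (1/lam) (left_weight z k (\<lambda>i. X i \<omega>)) (right_weight z k (\<lambda>i. X i \<omega>)) < c"
    proof (rule AE_function_of_weights_bounded[OF \<open>lam > 0\<close>])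
      show "lam * r * urn_potential (1/lam) l (r + 2) + l * urn_potential (1/lam) (l + 2) r
          \<le> (l + lam * r) * urn_potential (1/lam) l r" if "l \<ge> 1" "r \<ge> 1" for l r
        using mult_left_mono[OF urn_potential_supermartingale[OF inv that], of lam] \<open>lam > 0\<close>
        by (simp add: algebra_simps)
    qed (simp add: urn_potential_def)
    with step show "AE \<omega> in M. infinite {n. X n \<omega> = z} \<longrightarrow>
        (\<lambda>n. errw_weight (\<lambda>i. X i \<omega>) n (z - 1) /
          (errw_weight (\<lambda>i. X i \<omega>) n (z - 1) + lam * errw_weight (\<lambda>i. X i \<omega>) n z)) \<longlonglongrightarrow> 1"
    proof (eventually_elim, intro impI)
      fix \<omega>
      let ?x = "\<lambda>i. X i \<omega>"
      assume x: "\<forall>n. X (Suc n) \<omega> = X n \<omega> + 1 \<or> X (Suc n) \<omega> = X n \<omega> - 1" "infinite {n. X n \<omega> = z}"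
      assume "\<exists>c>0. \<forall>k. urn_potential (1/lam) (left_weight z k ?x) (right_weight z k ?x) < c"
      then obtain c where c: "\<And>k. urn_potential (1/lam) (left_weight z k ?x) (right_weight z k ?x) < c"
        by blast
      have "filterlim (\<lambda>n. left_weight z n ?x + right_weight z n ?x) at_top sequentially"
        using x by (intro total_weight_at_top) auto
      then have "(\<lambda>n. right_weight z n ?x / left_weight z n ?x) \<longlonglongrightarrow> 0"
        using c by (intro urn_ratio_tendsto_0[OF inv]) (auto simp: left_weight_ge_1 right_weight_ge_1)
      then have "(\<lambda>n. (1/lam) * errw_weight ?x n (z - 1) /
          (errw_weight ?x n z + (1/lam) * errw_weight ?x n (z - 1))) \<longlonglongrightarrow> 1"
        by (rule biased_fraction_tendsto_1[rotated])
          ((rule errw_weight_ge_1 right_weight_ge left_weight_le left_weight_ge_1)+, use \<open>lam > 0\<close> in simp)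
      moreover have "(1/lam) * u / (v + (1/lam) * u) = u / (u + lam * v)" for u v
        using \<open>lam > 0\<close> by (simp add: divide_simps) (simp add: algebra_simps)
      ultimately show "(\<lambda>n. errw_weight ?x n (z - 1) /
          (errw_weight ?x n (z - 1) + lam * errw_weight ?x n z)) \<longlonglongrightarrow> 1"
        by (simp only:)
    qed
  }
qed

end
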